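(* Let $R$ be an integral domain with fraction field $K$. Suppose that $R$ contains an element having two inequivalent factorizations into irreducibles, and that every element of $R$ which is not a square in $R$ is also not a square in $K$. Then there exists a polynomial $f\in R[x]$ of degree $4$ that is indecomposable over $R$ but decomposable over $K$.
   Context: For a ring $A$ and $f\in A[x]$ with $\deg f\ge 2$, $f$ is called decomposable over $A$ if $f(x)=g(h(x))$ for some $g,h\in A[x]$ of degree at least $2$, and indecomposable over $A$ otherwise. Two factorizations of an element into irreducibles are inequivalent if there is no bijection between the irreducible factors of the first and those of the second such that corresponding irreducibles are unit multiples of one another. *)

theory Defs
  imports "HOL-Computational_Algebra.Computational_Algebra"
begin

definition decomposable :: "'a::comm_ring_1 poly \<Rightarrow> bool" where
  "decomposable f \<longleftrightarrow> degree f \<ge> 2 \<and>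
     (\<exists>g h. degree g \<ge> 2 \<and> degree h \<ge> 2 \<and> f = pcompose g h)"

definition indecomposable :: "'a::comm_ring_1 poly \<Rightarrow> bool" where
  "indecomposable f \<longleftrightarrow> degree f \<ge> 2 \<and> \<not> decomposable f"

definition irred_factorization :: "'a::comm_ring_1 \<Rightarrow> 'a list \<Rightarrow> bool" where
  "irred_factorization a xs \<longleftrightarrow> (\<forall>x\<in>set xs. irreducible x) \<and> prod_list xs = a"

definition equiv_factorizations :: "'a::comm_ring_1 list \<Rightarrow> 'a list \<Rightarrow> bool" where
  "equiv_factorizations xs ys \<longleftrightarrow> length xs = length ys \<and>
     (\<exists>\<sigma>. bij_betw \<sigma> {..<length xs} {..<length ys} \<and>
        (\<forall>i<length xs. \<exists>u. u dvd 1 \<and> ys ! (\<sigma> i) = u * xs ! i))"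

end

theory Submission
  imports Defs "HOL-Combinatorics.List_Permutation"
begin

text \<open>
  Two inequivalent factorizations yield an irreducible \<open>p\<close> that is not prime, say \<open>p c = a b\<close>
  with \<open>p\<close> dividing neither \<open>a\<close> nor \<open>b\<close>. The polynomial
  \<open>f = (p x\<^sup>2 + a x)\<^sup>2 + (b / p) (p x\<^sup>2 + a x)\<close> then has coefficients in \<open>R\<close>. Suppose
  \<open>f = g(h)\<close> over \<open>R\<close>, with leading coefficients \<open>g\<^sub>2\<close>, \<open>h\<^sub>2\<close>. Then \<open>g\<^sub>2 = (p / h\<^sub>2)\<^sup>2\<close> is a square in
  \<open>K\<close>, hence \<open>g\<^sub>2 = s\<^sup>2\<close> with \<open>s \<in> R\<close> and \<open>s h\<^sub>2 = p\<close>, so \<open>s\<close> or \<open>h\<^sub>2\<close> is a unit.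
  Writing \<open>h\<^sub>1\<close> for the linear coefficient of \<open>h\<close> and \<open>k = s h\<^sub>1\<close>, comparing coefficients
  gives \<open>2 k = 2 a\<close> and \<open>(k - a) (k\<^sup>2 + a k - b) = 0\<close>. If \<open>k = a\<close>, then \<open>s\<close> divides \<open>a\<close> and \<open>h\<^sub>2\<close>
  divides \<open>b\<close>, which is impossible. The other root can occur only in characteristic 2, and
  there not for both \<open>b\<close> and \<open>b + p\<close>.
\<close>

section \<open>Uniqueness of factorizations into primes\<close>

lemma nonunit_dvd_irreducible:
  fixes p q :: "'a::idom"
  assumes "\<not> p dvd 1" "irreducible q" "p dvd q"
  obtains u where "u dvd 1" "q = u * p"
proof -
  obtain u where u: "q = p * u"
    using assms(3) by (auto elim: dvdE)
  then have "p dvd 1 \<or> u dvd 1"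
    using assms(2) irreducibleD by blast
  then show ?thesis
    using that[of u] u assms(1) by (auto simp: mult.commute)
qed

lemma prime_elem_dvd_prod_listE:
  assumes "prime_elem p" "p dvd prod_list ys"
  obtains y where "y \<in> set ys" "p dvd y"
  using assms(2) that
proof (induction ys arbitrary: thesis)
  case Nil
  then show ?case using assms(1) by (auto simp: prime_elem_def)
next
  case (Cons y ys)
  then have "p dvd y \<or> p dvd prod_list ys"
    using assms(1) by (simp add: prime_elem_dvd_mult_iff)
  then show ?case using Cons by (metis list.set_intros)
qed

text \<open>Induction on \<open>xs\<close>: the prime \<open>x\<close> divides some \<open>y\<close>
  in \<open>ys\<close> and is associated to it. Cancelling \<open>x\<close> leaves a unit, so the
  induction needs the slack \<open>v\<close>.\<close>

lemma prime_factorizations_associated: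
  fixes xs ys :: "'a::idom list"
  assumes "\<forall>x\<in>set xs. prime_elem x" "\<forall>y\<in>set ys. irreducible y"
    and "v dvd 1" "prod_list ys = v * prod_list xs"
  shows "\<exists>zs. mset zs = mset ys \<and> list_all2 (\<lambda>x z. \<exists>u. u dvd 1 \<and> z = u * x) xs zs"
  using assms
proof (induction xs arbitrary: ys v)
  case Nil
  have "ys = []"
  proof (cases ys)
    case (Cons y zs)
    then have "y dvd 1"
      using Nil by (auto intro: dvd_mult_left)
    then show ?thesis
      using Nil Cons by (auto simp: irreducible_def)
  qed simp
  then show ?case by simp
next
  case (Cons x xs)
  have x: "prime_elem x" "\<not> x dvd 1" "x \<noteq> 0"
    using Cons.prems(1) by (auto simp: prime_elem_def)
  then obtain y where y: "y \<in> set ys" "x dvd y"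
    using Cons.prems(4) prime_elem_dvd_prod_listE[of x ys] by auto
  then obtain u where u: "u dvd 1" "y = u * x"
    using nonunit_dvd_irreducible x(2) Cons.prems(2) by metis
  then obtain w where w: "u * w = 1"
    by (auto elim: dvdE)
  obtain ys1 ys2 where ys: "ys = ys1 @ y # ys2"
    using y(1) by (meson split_list)
  have "x * (u * prod_list (ys1 @ ys2)) = x * (v * prod_list xs)"
    using Cons.prems(4) u(2) ys by (simp add: ac_simps)
  then have "u * prod_list (ys1 @ ys2) = v * prod_list xs"
    using x(3) by simp
  then have "(u * w) * prod_list (ys1 @ ys2) = (w * v) * prod_list xs"
    by (metis mult.assoc mult.commute)
  then have "prod_list (ys1 @ ys2) = (w * v) * prod_list xs"
    using w by simp
  moreover have "w * v dvd 1"
    using w Cons.prems(3) by (metis dvd_triv_right mult_dvd_mono mult_1)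
  ultimately obtain zs where "mset zs = mset (ys1 @ ys2)"
      "list_all2 (\<lambda>x z. \<exists>u. u dvd 1 \<and> z = u * x) xs zs"
    using Cons.IH[of "ys1 @ ys2" "w * v"] Cons.prems ys by auto
  then show ?case
    using u ys by (intro exI[of _ "y # zs"]) auto
qed

lemma equiv_prime_factorizations:
  fixes xs ys :: "'a::idom list"
  assumes "\<forall>x\<in>set xs. prime_elem x" "\<forall>y\<in>set ys. irreducible y"
    and "prod_list xs = prod_list ys"
  shows "equiv_factorizations xs ys"
proof -
  obtain zs where zs: "mset zs = mset ys"
      "list_all2 (\<lambda>x z. \<exists>u. u dvd 1 \<and> z = u * x) xs zs"
    using prime_factorizations_associated[of xs ys 1] assms by auto
  obtain \<sigma> where "bij_betw \<sigma> {..<length zs} {..<length ys}"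
      "\<forall>i<length zs. zs ! i = ys ! \<sigma> i"
    using permutation_Ex_bij[OF zs(1)] by auto
  then show ?thesis
    using zs mset_eq_length[OF zs(1)]
    by (auto simp: equiv_factorizations_def list_all2_conv_all_nth)
qed

lemma inequivalent_factorizations_imp_nonprime_irreducible:
  fixes a :: "'a::idom"
  assumes "irred_factorization a xs" "irred_factorization a ys"
    and "\<not> equiv_factorizations xs ys"
  obtains p b c :: 'a where "irreducible p" "p dvd b * c" "\<not> p dvd b" "\<not> p dvd c"
proof -
  obtain p where "p \<in> set xs" "\<not> prime_elem p"
    using assms equiv_prime_factorizations[of xs ys] by (auto simp: irred_factorization_def)
  then show ?thesis
    using that assms(1) by (auto simp: irred_factorization_def prime_elem_def irreducible_def)
qed

section \<open>Decompositions of the quartic over the domain and its fraction field\<close>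

lemma square_factor_of_square:
  fixes d g p :: "'a::idom"
  assumes "\<forall>r::'a. (\<not> (\<exists>s. r = s ^ 2)) \<longrightarrow> \<not> (\<exists>k. to_fract r = k ^ 2)"
    and "g * d ^ 2 = p ^ 2" "p \<noteq> 0"
  obtains s where "g = s ^ 2" "s * d = p"
proof -
  have "d \<noteq> 0"
    using assms(2,3) by auto
  moreover have "to_fract g * to_fract d ^ 2 = to_fract p ^ 2"
    using arg_cong[OF assms(2), of to_fract] by (simp add: power2_eq_square)
  ultimately have "to_fract g = (to_fract p / to_fract d) ^ 2"
    by (simp add: power_divide field_simps)
  then obtain s where s: "g = s ^ 2"
    using assms(1) by blast
  then have "(s * d) ^ 2 = p ^ 2"
    using assms(2) by (simp add: power_mult_distrib)
  \<comment> \<open>Both \<open>s\<close> and \<open>- s\<close> are square roots of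
    \<open>g\<close>; the one whose product with \<open>d\<close> is \<open>p\<close> gets
    chosen.\<close>
  then have "s * d = p \<or> (- s) * d = p"
    by (auto simp: power2_eq_iff)
  then show ?thesis
    using that[of s] that[of "- s"] s by auto
qed

lemma degree_2_cases:
  assumes "degree q = 2"
  obtains q0 q1 q2 where "q = [:q0, q1, q2:]"
proof
  show "q = [:coeff q 0, coeff q 1, coeff q 2:]"
    using assms
    by (intro poly_eqI) (auto simp: coeff_pCons coeff_eq_0 numeral_2_eq_2 split: nat.splits)
qed

text \<open>The argument \<open>c\<close> stands for \<open>a b / p\<close>, which avoids division
  in the ring.\<close>

definition quartic :: "'a \<Rightarrow> 'a \<Rightarrow> 'a \<Rightarrow> 'a \<Rightarrow> 'a::idom poly" where
  "quartic p a b c = [:0, c, a ^ 2 + b, 2 * p * a, p ^ 2:]"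

lemma degree_quartic:
  assumes "p \<noteq> 0"
  shows "degree (quartic p a b c) = 4"
  using assms by (simp add: quartic_def)

lemma decomposable_map_quartic:
  fixes p a b c :: "'a::idom"
  assumes "p \<noteq> 0" "p * c = a * b"
  shows "decomposable (map_poly to_fract (quartic p a b c))"
proof -
  let ?g = "[:0, to_fract b / to_fract p, 1:]" and ?h = "[:0, to_fract a, to_fract p:]"
  have "to_fract p * to_fract c = to_fract a * to_fract b"
    using arg_cong[OF assms(2), of to_fract] by simp
  then have "to_fract c = to_fract a * to_fract b / to_fract p"
    using assms(1) by (simp add: field_simps)
  moreover have "to_fract (2 :: 'a) = 2"
    by (metis one_add_one to_fract_1 to_fract_add)
  ultimately have "map_poly to_fract (quartic p a b c) = pcompose ?g ?h"
    using assms(1)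
    by (simp add: quartic_def map_poly_pCons pcompose_pCons power2_eq_square field_simps)
  moreover have "degree ?g = 2" "degree ?h = 2"
    using assms(1) by auto
  ultimately show ?thesis
    unfolding decomposable_def by (metis degree_pcompose le_refl mult_2 trans_le_add1)
qed

lemma decomposable_quartic_imp_root:
  fixes p a b c :: "'a::idom"
  assumes sq: "\<forall>r::'a. (\<not> (\<exists>s. r = s ^ 2)) \<longrightarrow> \<not> (\<exists>k. to_fract r = k ^ 2)"
    and p: "irreducible p" and pc: "p * c = a * b" and na: "\<not> p dvd a" and nb: "\<not> p dvd b"
    and dec: "decomposable (quartic p a b c)"
  obtains k where "(2 :: 'a) = 0" "k ^ 2 + a * k = b" "p dvd a * (a + k)"
proof -
  have p0: "p \<noteq> 0"
    using p by (auto simp: irreducible_def)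
  obtain g h where gh: "degree g \<ge> 2" "degree h \<ge> 2" "quartic p a b c = pcompose g h"
    using dec by (auto simp: decomposable_def)
  have "degree g * degree h = 4"
    using gh(3) degree_quartic[OF p0, of a b c] by (simp add: degree_pcompose)
  moreover have "2 * degree h \<le> degree g * degree h" "degree g * 2 \<le> degree g * degree h"
    using gh by auto
  ultimately have "degree g = 2" "degree h = 2"
    using gh by auto
  then obtain g0 g1 g2 h0 h1 h2 where eq: "g = [:g0, g1, g2:]" "h = [:h0, h1, h2:]"
    by (metis degree_2_cases)
  \<comment> \<open>The linear coefficient of \<open>g (y + h0)\<close> in \<open>y\<close>; it
    absorbs the constant term of \<open>h\<close>.\<close>
  define n where "n = g1 + 2 * g2 * h0"
  have c4: "g2 * h2 ^ 2 = p ^ 2" and c3: "2 * (g2 * h2 * h1) = 2 * (p * a)"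
    and c2: "g2 * h1 ^ 2 + n * h2 = a ^ 2 + b" and c1: "n * h1 = c"
    using gh(3) unfolding eq quartic_def n_def
    by (auto simp: pcompose_pCons power2_eq_square algebra_simps)
  obtain s where s: "g2 = s ^ 2" "s * h2 = p"
    using square_factor_of_square[OF sq c4 p0] .
  define k where "k = s * h1"
  define m where "m = n * h2"
  have "p * (2 * k) = 2 * (g2 * h2 * h1)"
    unfolding k_def s(1) s(2)[symmetric] by (simp add: power2_eq_square)
  then have "p * (2 * k) = p * (2 * a)"
    using c3 by simp
  then have k2: "2 * k = 2 * a"
    using p0 by simp
  have km: "k ^ 2 + m = a ^ 2 + b" "m * k = a * b"
    using c2 c1 s pc unfolding k_def m_def by (auto simp: power2_eq_square algebra_simps)
  have su: "s dvd 1 \<or> h2 dvd 1"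
    using p s(2) irreducibleD by blast
  have sk: "s dvd k" and hm: "h2 dvd m"
    by (simp_all add: k_def m_def)
  have p_dvd: "p dvd x" if "h2 dvd 1" "s dvd x" for x
    using mult_dvd_mono[OF that(2,1)] s(2) by simp
  have p_dvd': "p dvd x" if "s dvd 1" "h2 dvd x" for x
    using mult_dvd_mono[OF that] s(2) by simp
  have ka: "k \<noteq> a"
  proof
    assume "k = a"
    then have "m = b"
      using km by simp
    then show False
      using \<open>k = a\<close> su sk hm p_dvd p_dvd' na nb by metis
  qed
  then have two: "(2 :: 'a) = 0"
    using k2 by (metis mult_cancel_left)
  have m: "m = a ^ 2 + b - k ^ 2"
    using km(1) by (metis add_diff_cancel_left')
  \<comment> \<open>Eliminating \<open>m\<close> from the two equations \<open>km\<close> leaves a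
    cubic in \<open>k\<close> with the known root \<open>a\<close>.\<close>
  have "(k - a) * (k ^ 2 + a * k - b) = a * b - m * k"
    unfolding m by (simp add: power2_eq_square algebra_simps)
  then have b: "k ^ 2 + a * k = b"
    using ka km(2) by simp
  \<comment> \<open>If \<open>h2\<close> were a unit, \<open>p\<close> would be associated to
    \<open>s\<close> and so divide \<open>k\<close>, hence \<open>b\<close>. Thus \<open>s\<close>
    is the unit, and \<open>p\<close> divides \<open>m\<close> because \<open>h2\<close>
    does.\<close>
  then have "k dvd b"
    by (metis dvd_triv_left dvd_triv_right dvd_add power2_eq_square)
  then have "s dvd 1"
    using su sk p_dvd nb dvd_trans by metis
  moreover have "m = a * (a + k)"
    unfolding m b[symmetric] by (simp add: power2_eq_square algebra_simps)
  ultimately show ?thesis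
    using that two b p_dvd' hm by metis
qed

text \<open>If both quartics decomposed, the difference \<open>d\<close> of the two roots would
  satisfy \<open>d * (d + a) = p\<close> in characteristic 2, so one factor is a unit. A unit
  \<open>d\<close> forces \<open>p\<close> to divide \<open>a\<close>, a unit \<open>d + a\<close>
  forces it to divide \<open>b\<close>.\<close>

lemma indecomposable_quartic:
  fixes p a b c :: "'a::idom"
  assumes sq: "\<forall>r::'a. (\<not> (\<exists>s. r = s ^ 2)) \<longrightarrow> \<not> (\<exists>k. to_fract r = k ^ 2)"
    and p: "irreducible p" and pc: "p * c = a * b" and na: "\<not> p dvd a" and nb: "\<not> p dvd b"
  shows "indecomposable (quartic p a b c) \<or> indecomposable (quartic p a (b + p) (c + a))"
proof (rule ccontr)
  assume "\<not> ?thesis"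
  then have dec: "decomposable (quartic p a b c)" "decomposable (quartic p a (b + p) (c + a))"
    using p degree_quartic[of p] by (auto simp: indecomposable_def irreducible_def)
  obtain h where h: "(2 :: 'a) = 0" "h ^ 2 + a * h = b" "p dvd a * (a + h)"
    using decomposable_quartic_imp_root[OF sq p pc na nb dec(1)] .
  have "p * (c + a) = a * (b + p)" "\<not> p dvd b + p"
    using pc nb by (simp_all add: algebra_simps dvd_add_left_iff)
  then obtain k where k: "k ^ 2 + a * k = b + p" "p dvd a * (a + k)"
    using decomposable_quartic_imp_root[OF sq p _ na _ dec(2)] by blast
  define d where "d = k - h"
  have "d * (d + a) = (k ^ 2 + a * k) - (h ^ 2 + a * h) + 2 * (h * (h - k))"
    by (simp add: d_def power2_eq_square algebra_simps)
  then have d: "d * (d + a) = p"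
    using h k by simp
  have "d dvd 1 \<or> d + a dvd 1"
    using p d irreducibleD by metis
  then show False
  proof
    assume "d dvd 1"
    have "a * d = a * (a + k) - a * (a + h)"
      by (simp add: d_def algebra_simps)
    then have "p dvd a * d"
      using h k by (metis dvd_diff)
    then show False
      using \<open>d dvd 1\<close> na by (metis dvd_trans mult.right_neutral mult_dvd_mono dvd_refl)
  next
    assume unit: "d + a dvd 1"
    \<comment> \<open>Now \<open>p\<close> divides \<open>d\<close>, so it divides both
      \<open>d * b\<close> and \<open>a * b\<close>, and the unit \<open>d + a\<close> can be
      cancelled from their sum.\<close>
    then have "d * (d + a) dvd d * 1"
      by (intro mult_dvd_mono) auto
    then have "p dvd d * b"
      using d by (simp add: dvd_mult2)
    moreover have "p dvd a * b"
      using pc by (metis dvd_triv_left)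
    ultimately have "p dvd (d + a) * b"
      by (simp add: distrib_right)
    then show False
      using unit nb by (metis dvd_trans mult_1 mult_dvd_mono dvd_refl)
  qed
qed

theorem theorem3p2:
  fixes a :: "'a::idom"
  assumes "irred_factorization a xs" and "irred_factorization a ys"
    and "\<not> equiv_factorizations xs ys"
    and "\<forall>r::'a. (\<not> (\<exists>s. r = s ^ 2)) \<longrightarrow> \<not> (\<exists>k. to_fract r = k ^ 2)"
  shows "\<exists>f :: 'a poly. degree f = 4 \<and> indecomposable f \<and>
           decomposable (map_poly to_fract f)"
proof -
  obtain p b c :: 'a where p: "irreducible p" "p dvd b * c" "\<not> p dvd b" "\<not> p dvd c"
    using inequivalent_factorizations_imp_nonprime_irreducible[OF assms(1-3)] .
  obtain d where d: "p * d = b * c"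
    using p(2) by (metis dvdE)
  \<comment> \<open>With this relation the alternative quartic decomposes over the fraction field as
    well.\<close>
  then have "p * (d + b) = b * (c + p)"
    by (simp add: algebra_simps)
  moreover have "p \<noteq> 0"
    using p(1) by (auto simp: irreducible_def)
  ultimately show ?thesis
    using indecomposable_quartic[OF assms(4) p(1) d p(3,4)] d
      degree_quartic decomposable_map_quartic by metis
qed

end
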